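(* Let $g$ be an analytic function in $\mathbb{D}$. Then: (i) $I_g$ maps $B^1$ into $\mathcal{B}$ if and only if $g\in H^\infty$. (ii) $M_g$ maps $B^1$ into $\mathcal{B}$ if and only if $g\in H^\infty$. (iii) $T_g$ maps $B^1$ into $\mathcal{B}$ if and only if $g\in\mathcal{B}$.
   Context: $\mathbb{D}$ is the open unit disc in $\mathbb{C}$ and $dA$ is the normalized Lebesgue area measure on $\mathbb{D}$. $H^\infty$ is the space of bounded analytic functions in $\mathbb{D}$. $B^1$ is the space of all analytic functions $f$ in $\mathbb{D}$ with $\int_{\mathbb{D}}|f''(z)|\,dA(z)<\infty$. The Bloch space $\mathcal{B}$ is the space of all analytic $f$ in $\mathbb{D}$ with $\sup_{z\in\mathbb{D}}(1-|z|^2)|f'(z)|<\infty$. For $g$ and $f$ analytic in $\mathbb{D}$ and $z\in\mathbb{D}$: $T_g(f)(z)=\int_0^z g'(\xi)f(\xi)\,d\xi$, $I_g(f)(z)=\int_0^z g(\xi)f'(\xi)\,d\xi$, $M_g(f)(z)=g(z)f(z)$. An operator $T$ maps $X$ into $Y$ if $T(X)\subset Y$. *)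

theory Defs
  imports "HOL-Complex_Analysis.Complex_Analysis"
begin

text \<open>
  Functions on the unit disc are represented by total functions \<^typ>\<open>complex \<Rightarrow> complex\<close>; all notions
  below depend only on the values on the disc. As the disc is open, \<^const>\<open>deriv\<close> taken at its points is
  the derivative of the restriction.
\<close>

abbreviation unit_disc :: "complex set" where
  "unit_disc \<equiv> ball 0 1"

definition disc_area :: "complex measure" where
  "disc_area = uniform_measure lborel unit_disc"

definition H_infinity :: "(complex \<Rightarrow> complex) set" where
  "H_infinity = {f. f holomorphic_on unit_disc \<and> bounded (f ` unit_disc)}"

text \<open>
  The integral is already concentrated on the disc; restricting the integrand as well makes
  it Borel measurable whatever the values of the function outside the disc.
\<close>

definition B_one :: "(complex \<Rightarrow> complex) set" where
  "B_one = {f. f holomorphic_on unit_disc \<and>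
      (\<integral>\<^sup>+z\<in>unit_disc. ennreal (cmod (deriv (deriv f) z)) \<partial>disc_area) < \<infinity>}"

definition Bloch :: "(complex \<Rightarrow> complex) set" where
  "Bloch = {f. f holomorphic_on unit_disc \<and>
      bdd_above ((\<lambda>z. (1 - (cmod z)\<^sup>2) * cmod (deriv f z)) ` unit_disc)}"

definition T_op :: "(complex \<Rightarrow> complex) \<Rightarrow> (complex \<Rightarrow> complex) \<Rightarrow> complex \<Rightarrow> complex" where
  "T_op g f = (\<lambda>z. contour_integral (linepath 0 z) (\<lambda>\<xi>. deriv g \<xi> * f \<xi>))"

definition I_op :: "(complex \<Rightarrow> complex) \<Rightarrow> (complex \<Rightarrow> complex) \<Rightarrow> complex \<Rightarrow> complex" where
  "I_op g f = (\<lambda>z. contour_integral (linepath 0 z) (\<lambda>\<xi>. g \<xi> * deriv f \<xi>))"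

definition M_op :: "(complex \<Rightarrow> complex) \<Rightarrow> (complex \<Rightarrow> complex) \<Rightarrow> complex \<Rightarrow> complex" where
  "M_op g f = (\<lambda>z. g z * f z)"

definition maps_into :: "('a \<Rightarrow> 'b) \<Rightarrow> 'a set \<Rightarrow> 'b set \<Rightarrow> bool" where
  "maps_into T X Y \<longleftrightarrow> T ` X \<subseteq> Y"

end

theory Submission
  imports Defs
begin

text \<open>
  The differentiation rules \<open>(I_op g f)' = g f'\<close>, \<open>(T_op g f)' = g' f\<close> and
  \<open>(M_op g f)' = g f' + g' f\<close> together with \<open>B_one \<subseteq> H_infinity \<subseteq> Bloch\<close> give the
  sufficiency of all three conditions. Testing on \<open>f = 1\<close> gives necessity for \<open>T_op\<close>, and
  for \<open>M_op\<close> it shows \<open>g \<in> Bloch\<close>, which makes the term \<open>g' f\<close> harmless. So everything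
  reduces to one claim: if \<open>(1 - |z|\<^sup>2) |g f'|\<close> is bounded for every \<open>f\<close> in \<open>B_one\<close>, then
  \<open>g\<close> is bounded. Instead of the closed graph theorem a gliding hump is used: the functions with
  second derivative a multiple of \<open>(1 - |a|\<^sup>2)\<^sup>2 / (1 - cnj a z)^4\<close> have bounded norm in
  \<open>B_one\<close>, while \<open>(1 - |a|\<^sup>2) |f'(a)|\<close> stays bounded below; if \<open>g\<close> were unbounded, a
  geometrically weighted sum of them along suitable points \<open>a\<close> would violate the hypothesis.
\<close>

section \<open>Integral estimates and the area mean value inequality\<close>

text \<open>Cauchy's formula and the fundamental theorem of calculus produce gauge integrals,
  whereas Tonelli's theorem works with nonnegative Lebesgue integrals. This is the passage from the
  former to the latter.\<close>

lemma ennreal_norm_integral_le: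
  fixes f :: "real \<Rightarrow> 'a::euclidean_space"
  assumes "continuous_on {a..b} f"
  shows "ennreal (norm (integral {a..b} f)) \<le> (\<integral>\<^sup>+t\<in>{a..b}. ennreal (norm (f t)) \<partial>lborel)"
proof -
  have int: "set_integrable lborel {a..b} f"
    using assms by (rule borel_integrable_atLeastAtMost')
  then have "integral {a..b} f = (\<integral>t. indicator {a..b} t *\<^sub>R f t \<partial>lborel)"
    using set_borel_integral_eq_integral(2) unfolding set_lebesgue_integral_def by metis
  then have "ennreal (norm (integral {a..b} f))
      \<le> (\<integral>\<^sup>+t. ennreal (norm (indicator {a..b} t *\<^sub>R f t)) \<partial>lborel)"
    using integral_norm_bound_ennreal[of lborel "\<lambda>t. indicator {a..b} t *\<^sub>R f t"] int
    by (simp add: set_integrable_def)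
  also have "\<dots> = (\<integral>\<^sup>+t\<in>{a..b}. ennreal (norm (f t)) \<partial>lborel)"
    by (intro nn_integral_cong) (auto simp: indicator_def)
  finally show ?thesis .
qed

lemma borel_measurable_norm_indicator:
  fixes h :: "'a::topological_space \<Rightarrow> 'b::{real_normed_vector, second_countable_topology}"
  assumes "open S" "continuous_on S h"
  shows "(\<lambda>w. ennreal (norm (h w)) * indicator S w) \<in> borel_measurable borel"
proof -
  have "(\<lambda>w. indicator S w *\<^sub>R h w) \<in> borel_measurable borel"
    using assms by (intro borel_measurable_continuous_on_indicator) auto
  then have "(\<lambda>w. ennreal (norm (indicator S w *\<^sub>R h w))) \<in> borel_measurable borel"
    by measurable
  also have "(\<lambda>w. ennreal (norm (indicator S w *\<^sub>R h w))) = (\<lambda>w. ennreal (norm (h w)) * indicator S w)"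
    by (auto simp: indicator_def)
  finally show ?thesis .
qed

lemma emeasure_lborel_ball_complex:
  fixes c :: complex
  assumes "r \<ge> 0"
  shows "emeasure lborel (ball c r) = ennreal (pi * r\<^sup>2)"
  using emeasure_ball[OF assms, of c] by (simp add: unit_ball_vol_2)

text \<open>
  Averaging Cauchy's formula over the centre of the circle, rather than over its radius, needs only
  translation invariance of Lebesgue measure and Tonelli's theorem; polar coordinates are avoided.
\<close>

lemma holomorphic_area_submean:
  assumes hol: "h holomorphic_on ball z R" and R: "R > 0"
  shows "ennreal (cmod (h z) * R\<^sup>2) \<le> 32 * (\<integral>\<^sup>+w\<in>ball z R. ennreal (cmod (h w)) \<partial>lborel)"
proof -
  define H where "H = (\<lambda>w. ennreal (cmod (h w)) * indicator (ball z R) w)"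
  \<comment> \<open>\<open>v\<close> runs through the circle of radius R/2 about 0. For a centre
    \<open>c\<close> within R/4 of \<open>z\<close>, the shifted circle encloses \<open>z\<close>,
    stays in \<open>ball z R\<close> and keeps distance at least R/4 from \<open>z\<close>.\<close>
  define v where "v = (\<lambda>t. (R/2) * exp (2 * of_real pi * \<i> * of_real t) :: complex)"
  have H_meas [measurable]: "H \<in> borel_measurable borel"
    unfolding H_def using hol
    by (intro borel_measurable_norm_indicator) (auto intro: holomorphic_on_imp_continuous_on)
  have v_meas [measurable]: "v \<in> borel_measurable borel"
    unfolding v_def by (intro borel_measurable_continuous_onI continuous_intros)
  have norm_v: "cmod (v t) = R/2" for t
    using R by (simp add: v_def norm_mult)
  \<comment> \<open>The factor 2 is the radius R/2 divided by the lower bound R/4 for the distance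
    to \<open>z\<close>.\<close>
  have cauchy: "ennreal (cmod (h z)) \<le> (\<integral>\<^sup>+t\<in>{0..1}. 2 * H (c + v t) \<partial>lborel)"
    if c: "c \<in> ball z (R/4)" for c
  proof -
    have sub: "cball c (R/2) \<subseteq> ball z R"
      using c R by (intro subsetI) (auto simp: dist_norm, smt (verit) norm_triangle_ineq4 c dist_norm mem_ball dist_commute dist_triangle)
    have cz: "cmod (z - c) < R/4" using c by (simp add: dist_norm)
    have H_eq: "H (c + v t) = ennreal (cmod (h (c + v t)))" for t
      using sub norm_v[of t] R by (auto simp: H_def dist_norm subset_iff)
    define F where "F = (\<lambda>t. h (c + v t) / (c + v t - z) * (2 * pi * \<i> * v t))"
    have "((\<lambda>u. h u / (u - z)) has_contour_integral (2 * of_real pi * \<i> * h z)) (circlepath c (R/2))"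
      using sub cz R holomorphic_on_subset[OF hol sub]
      by (intro Cauchy_integral_circlepath)
         (auto intro: holomorphic_on_imp_continuous_on holomorphic_on_subset)
    then have "(F has_integral (2 * of_real pi * \<i> * h z)) {0..1}"
      unfolding has_contour_integral_def
    proof (rule has_integral_eq[rotated])
      fix t :: real assume t: "t \<in> {0..1}"
      have "circlepath c (R/2) t = c + v t"
        by (simp add: circlepath v_def)
      moreover have "vector_derivative (circlepath c (R/2)) (at t within {0..1}) = 2 * pi * \<i> * v t"
        using t by (subst vector_derivative_circlepath01) (auto simp: v_def)
      ultimately show "h (circlepath c (R/2) t) / (circlepath c (R/2) t - z) *
          vector_derivative (circlepath c (R/2)) (at t within {0..1}) = F t"
        by (simp add: F_def)
    qed
    then have int: "integral {0..1} F = 2 * of_real pi * \<i> * h z" by (rule integral_unique)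
    have far: "cmod (c + v t - z) \<ge> R/4" for t
      using norm_triangle_ineq2[of "v t" "z - c"] norm_v[of t] cz by (simp add: algebra_simps)
    have "continuous_on {0..1} (\<lambda>t. h (c + v t))"
      using sub norm_v R
      by (intro continuous_on_compose2[OF holomorphic_on_imp_continuous_on[OF hol]])
         (auto simp: v_def dist_norm subset_iff intro!: continuous_intros)
    moreover have "c + v t - z \<noteq> 0" for t using far[of t] R by auto
    ultimately have cont: "continuous_on {0..1} F"
      unfolding F_def by (intro continuous_intros) (auto simp: v_def intro!: continuous_intros)
    have "ennreal (2 * pi) * ennreal (cmod (h z)) = ennreal (cmod (integral {0..1} F))"
      by (simp add: int norm_mult ennreal_mult)
    also have "\<dots> \<le> (\<integral>\<^sup>+t\<in>{0..1}. ennreal (cmod (F t)) \<partial>lborel)"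
      by (rule ennreal_norm_integral_le[OF cont])
    also have "\<dots> \<le> (\<integral>\<^sup>+t. ennreal (2 * pi) * (2 * H (c + v t) * indicator {0..1} t) \<partial>lborel)"
    proof (intro nn_integral_mono)
      fix t :: real
      have "cmod (F t) = cmod (h (c + v t)) / cmod (c + v t - z) * (pi * R)"
        by (simp add: F_def norm_mult norm_divide norm_v)
      also have "\<dots> \<le> cmod (h (c + v t)) / (R/4) * (pi * R)"
        using far[of t] R by (intro mult_right_mono divide_left_mono mult_pos_pos) (linarith | simp)+
      also have "\<dots> = 2 * pi * (2 * cmod (h (c + v t)))" using R by simp
      finally show "ennreal (cmod (F t)) * indicator {0..1} t
          \<le> ennreal (2 * pi) * (2 * H (c + v t) * indicator {0..1} t)"
        by (auto simp: indicator_def H_eq ennreal_mult[symmetric] simp flip: ennreal_numeral intro!: ennreal_leI)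
    qed
    also have "\<dots> = ennreal (2 * pi) * (\<integral>\<^sup>+t\<in>{0..1}. 2 * H (c + v t) \<partial>lborel)"
      by (rule nn_integral_cmult) measurable
    finally show ?thesis
      by (subst (asm) ennreal_mult_le_mult_iff) auto
  qed
  have translate: "(\<integral>\<^sup>+c. H (c + u) \<partial>lborel) = (\<integral>\<^sup>+w. H w \<partial>lborel)" for u
  proof -
    have "(\<integral>\<^sup>+w. H w \<partial>lborel) = (\<integral>\<^sup>+w. H w \<partial>distr lborel borel ((+) u))"
      by (simp add: lborel_distr_plus)
    also have "\<dots> = (\<integral>\<^sup>+c. H (c + u) \<partial>lborel)"
      by (subst nn_integral_distr) (auto simp: add.commute)
    finally show ?thesis ..
  qed
  \<comment> \<open>The bound \<open>cauchy\<close> is integrated over all centres \<open>c\<close>.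
    After the order of integration is exchanged, each fixed \<open>t\<close> contributes a translate
    of \<open>H\<close>, whose integral over the plane does not depend on \<open>t\<close>.\<close>
  have "ennreal (cmod (h z)) * ennreal (pi * (R/4)\<^sup>2)
      = (\<integral>\<^sup>+c\<in>ball z (R/4). ennreal (cmod (h z)) \<partial>lborel)"
    using R emeasure_lborel_ball_complex[of "R/4" z] by (simp add: nn_integral_cmult_indicator)
  also have "\<dots> \<le> (\<integral>\<^sup>+c. (\<integral>\<^sup>+t. 2 * H (c + v t) * indicator {0..1} t \<partial>lborel) \<partial>lborel)"
    using cauchy by (intro nn_integral_mono) (auto simp: indicator_def)
  also have "\<dots> = (\<integral>\<^sup>+t. (\<integral>\<^sup>+c. 2 * H (c + v t) * indicator {0..1} t \<partial>lborel) \<partial>lborel)"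
    by (subst lborel_pair.Fubini') auto
  also have "\<dots> = (\<integral>\<^sup>+t. 2 * (\<integral>\<^sup>+w. H w \<partial>lborel) * indicator {0..1::real} t \<partial>lborel)"
    by (intro nn_integral_cong) (simp add: nn_integral_multc nn_integral_cmult translate)
  also have "\<dots> = 2 * (\<integral>\<^sup>+w. H w \<partial>lborel)"
    by (simp add: nn_integral_cmult_indicator)
  finally have main: "ennreal (cmod (h z)) * ennreal (pi * (R/4)\<^sup>2) \<le> 2 * (\<integral>\<^sup>+w. H w \<partial>lborel)" .
  \<comment> \<open>The disc of centres has area pi R^2 / 16, and pi is estimated below by 1; so 32
    is 16 times the factor 2 in \<open>main\<close>.\<close>
  have "ennreal (cmod (h z) * R\<^sup>2) \<le> ennreal (16 * (cmod (h z) * (pi * (R/4)\<^sup>2)))"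
    using mult_right_mono[of 1 pi "R\<^sup>2"] pi_gt3
    by (intro ennreal_leI) (auto simp: power_divide intro!: mult_left_mono)
  also have "\<dots> = 16 * (ennreal (cmod (h z)) * ennreal (pi * (R/4)\<^sup>2))"
    by (simp add: ennreal_mult)
  also have "\<dots> \<le> 16 * (2 * (\<integral>\<^sup>+w. H w \<partial>lborel))"
    by (intro mult_left_mono main) auto
  also have "\<dots> = 32 * (\<integral>\<^sup>+w. H w \<partial>lborel)"
    by (simp add: mult.assoc[symmetric])
  also have "(\<integral>\<^sup>+w. H w \<partial>lborel) = (\<integral>\<^sup>+w\<in>ball z R. ennreal (cmod (h w)) \<partial>lborel)"
    by (simp add: H_def)
  finally show ?thesis .
qed

section \<open>Growth of the derivative and boundedness for functions in
  \<open>B_one\<close>\<close>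

text \<open>Dividing by the area pi of the disc does not affect finiteness, so the estimates can be
  carried out with plain Lebesgue measure.\<close>

lemma B_one_iff:
  "f \<in> B_one \<longleftrightarrow> f holomorphic_on unit_disc \<and>
     (\<integral>\<^sup>+z\<in>unit_disc. ennreal (cmod (deriv (deriv f) z)) \<partial>lborel) < \<infinity>"
proof (cases "f holomorphic_on unit_disc")
  case True
  then have "deriv (deriv f) holomorphic_on unit_disc"
    by (intro holomorphic_deriv) auto
  then have meas: "(\<lambda>z. ennreal (cmod (deriv (deriv f) z)) * indicator unit_disc z) \<in> borel_measurable lborel"
    using borel_measurable_norm_indicator[of unit_disc "deriv (deriv f)"]
    by (auto dest: holomorphic_on_imp_continuous_on)
  have "(\<integral>\<^sup>+z\<in>unit_disc. ennreal (cmod (deriv (deriv f) z)) \<partial>disc_area)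
      = (\<integral>\<^sup>+z\<in>unit_disc. ennreal (cmod (deriv (deriv f) z)) \<partial>lborel) / ennreal pi"
    unfolding disc_area_def using meas
    by (subst nn_integral_uniform_measure)
       (auto simp: emeasure_lborel_ball_complex mult.assoc simp flip: indicator_inter_arith)
  then show ?thesis
    using True by (simp add: B_one_def ennreal_divide_eq_top_iff flip: less_top)
qed (simp add: B_one_def)

lemma unit_direction:
  obtains \<zeta> :: complex where "cmod \<zeta> = 1" "z = of_real (cmod z) * \<zeta>"
proof (cases "z = 0")
  case True then show ?thesis using that[of 1] by simp
next
  case False
  then have "cmod (sgn z) = 1" "z = of_real (cmod z) * sgn z"
    by (simp_all add: norm_sgn sgn_eq norm_divide)
  then show ?thesis by (rule that)
qed

lemma has_vector_derivative_along_ray: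
  assumes "(F has_field_derivative D) (at (of_real t * \<zeta>))"
  shows "((\<lambda>t. F (of_real t * \<zeta>)) has_vector_derivative D * \<zeta>) (at t within S)"
proof -
  have "((\<lambda>u. u * \<zeta>) has_field_derivative \<zeta>) (at (of_real t))"
    by (auto intro!: derivative_eq_intros)
  from DERIV_chain2[OF assms this] show ?thesis
    by (rule has_vector_derivative_real_field)
qed

text \<open>The area mean value inequality on the disc about z of radius 1 - |z| gives |f''(z)| =
  O((1 - |z|)^(-2)). Integrating along the radius improves the exponent by one.\<close>

lemma one_minus_norm_deriv_bounded:
  assumes hol: "f holomorphic_on unit_disc"
    and fin: "(\<integral>\<^sup>+z\<in>unit_disc. ennreal (cmod (deriv (deriv f) z)) \<partial>lborel) < \<infinity>"
  obtains K where "\<And>z. z \<in> unit_disc \<Longrightarrow> (1 - cmod z) * cmod (deriv f z) \<le> K"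
proof -
  let ?h = "deriv (deriv f)"
  have hol1: "deriv f holomorphic_on unit_disc" and hol2: "?h holomorphic_on unit_disc"
    using hol by (auto intro!: holomorphic_deriv)
  obtain N where N: "N \<ge> 0"
      "(\<integral>\<^sup>+z\<in>unit_disc. ennreal (cmod (?h z)) \<partial>lborel) = ennreal N"
    using fin by (cases "\<integral>\<^sup>+z\<in>unit_disc. ennreal (cmod (?h z)) \<partial>lborel") auto
  have h_le: "cmod (?h z) \<le> 32 * N / (1 - cmod z)\<^sup>2" if z: "z \<in> unit_disc" for z
  proof -
    have sub: "ball z (1 - cmod z) \<subseteq> unit_disc"
      by (intro subsetI) (auto simp: dist_norm, smt (verit) norm_triangle_sub norm_minus_commute)
    have "ennreal (cmod (?h z) * (1 - cmod z)\<^sup>2)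
        \<le> 32 * (\<integral>\<^sup>+w\<in>ball z (1 - cmod z). ennreal (cmod (?h w)) \<partial>lborel)"
      using z sub hol2 by (intro holomorphic_area_submean) (auto intro: holomorphic_on_subset)
    also have "\<dots> \<le> 32 * (\<integral>\<^sup>+w\<in>unit_disc. ennreal (cmod (?h w)) \<partial>lborel)"
      using sub by (intro mult_left_mono nn_integral_mono) (auto simp: indicator_def)
    also have "\<dots> = ennreal (32 * N)"
      using N by (simp add: ennreal_mult)
    finally have "cmod (?h z) * (1 - cmod z)\<^sup>2 \<le> 32 * N"
      using N by simp
    then show ?thesis using z by (simp add: field_simps)
  qed
  show ?thesis
  proof (rule that[of "cmod (deriv f 0) + 32 * N"])
    fix z :: complex assume z: "z \<in> unit_disc"
    obtain \<zeta> where \<zeta>: "cmod \<zeta> = 1" "z = of_real (cmod z) * \<zeta>" by (rule unit_direction)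
    have "cmod (deriv f z - deriv f 0) \<le> 32 * N / (1 - cmod z) - 32 * N"
    proof (cases "z = 0")
      case False
      have disc: "of_real t * \<zeta> \<in> unit_disc" if "0 \<le> t" "t \<le> cmod z" for t :: real
        using that z \<zeta> by (simp add: norm_mult)
      have der: "((\<lambda>t. deriv f (of_real t * \<zeta>)) has_vector_derivative ?h (of_real t * \<zeta>) * \<zeta>) (at t)"
        if "0 \<le> t" "t \<le> cmod z" for t :: real
        using hol1 disc[OF that] by (intro has_vector_derivative_along_ray holomorphic_derivI) auto
      \<comment> \<open>The majorant 32 N / (1 - t) is a primitive of the bound on |f''| at the
        point of the ray with modulus t.\<close>
      have "cmod (deriv f (of_real (cmod z) * \<zeta>) - deriv f (of_real 0 * \<zeta>))
          \<le> 32 * N / (1 - cmod z) - 32 * N / (1 - 0)"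
      proof (rule differentiable_bound_general[where f = "\<lambda>t. deriv f (of_real t * \<zeta>)"
             and f' = "\<lambda>t. ?h (of_real t * \<zeta>) * \<zeta>" and \<phi> = "\<lambda>t. 32 * N / (1 - t)"
             and \<phi>' = "\<lambda>t. 32 * N / (1 - t)\<^sup>2"])
        show "0 < cmod z" using False by simp
        show "continuous_on {0..cmod z} (\<lambda>t. deriv f (of_real t * \<zeta>))"
          using der by (intro continuous_at_imp_continuous_on ballI has_vector_derivative_continuous) auto
        show "continuous_on {0..cmod z} (\<lambda>t. 32 * N / (1 - t))"
          using z by (intro continuous_intros) auto
        show "((\<lambda>t. 32 * N / (1 - t)) has_vector_derivative 32 * N / (1 - t)\<^sup>2) (at t)"
          if "0 < t" "t < cmod z" for t
          using that z unfolding has_real_derivative_iff_has_vector_derivative[symmetric]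
          by (auto intro!: derivative_eq_intros simp: power2_eq_square)
        show "cmod (?h (of_real t * \<zeta>) * \<zeta>) \<le> 32 * N / (1 - t)\<^sup>2" if "0 < t" "t < cmod z" for t
          using h_le[OF disc[of t]] that \<zeta> by (simp add: norm_mult)
      qed (use der in auto)
      then show ?thesis using \<zeta> by simp
    qed simp
    then have "cmod (deriv f z) \<le> cmod (deriv f 0) + (32 * N / (1 - cmod z) - 32 * N)"
      using norm_triangle_sub[of "deriv f z" "deriv f 0"] by linarith
    then have "(1 - cmod z) * cmod (deriv f z)
        \<le> (1 - cmod z) * (cmod (deriv f 0) + (32 * N / (1 - cmod z) - 32 * N))"
      using z by (intro mult_left_mono) auto
    also have "\<dots> = (1 - cmod z) * cmod (deriv f 0) + 32 * N - (1 - cmod z) * (32 * N)"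
      using z by (simp add: field_simps)
    also have "\<dots> \<le> cmod (deriv f 0) + 32 * N"
    proof -
      have "(1 - cmod z) * cmod (deriv f 0) \<le> cmod (deriv f 0)" "0 \<le> (1 - cmod z) * (32 * N)"
        using z N by (simp_all add: mult_left_le_one_le)
      then show ?thesis by linarith
    qed
    finally show "(1 - cmod z) * cmod (deriv f z) \<le> cmod (deriv f 0) + 32 * N" .
  qed
qed


text \<open>
  On the ray towards \<open>\<zeta>\<close> with \<open>|\<zeta>| = 1\<close> put \<open>G = f + (\<zeta> - z) f'\<close>. Then
  \<open>G' = (\<zeta> - z) f''\<close>, and \<open>G\<close> differs from \<open>f\<close> by a bounded term. The mean value
  inequality on the discs with centre \<open>t \<zeta>\<close> and radius \<open>(1 - t) / 2\<close> bounds the variation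
  of \<open>G\<close> by the area integral of \<open>|f''|\<close>, since a point \<open>w\<close> lies in such a disc only
  when \<open>1 - t\<close> is comparable to \<open>|\<zeta> - w|\<close>.
\<close>

lemma bounded_on_disc:
  assumes hol: "f holomorphic_on unit_disc"
    and fin: "(\<integral>\<^sup>+z\<in>unit_disc. ennreal (cmod (deriv (deriv f) z)) \<partial>lborel) < \<infinity>"
  obtains K where "\<And>z. z \<in> unit_disc \<Longrightarrow> cmod (f z) \<le> K"
proof -
  let ?h = "deriv (deriv f)"
  have hol1: "deriv f holomorphic_on unit_disc" and hol2: "?h holomorphic_on unit_disc"
    using hol by (auto intro!: holomorphic_deriv)
  define H where "H = (\<lambda>w. ennreal (cmod (?h w)) * indicator unit_disc w)"
  have H_meas [measurable]: "H \<in> borel_measurable borel"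
    unfolding H_def using hol2
    by (intro borel_measurable_norm_indicator) (auto intro: holomorphic_on_imp_continuous_on)
  obtain N where N: "N \<ge> 0" "(\<integral>\<^sup>+w. H w \<partial>lborel) = ennreal N"
    using fin unfolding H_def by (cases "\<integral>\<^sup>+z\<in>unit_disc. ennreal (cmod (?h z)) \<partial>lborel") auto
  obtain K where K: "\<And>z. z \<in> unit_disc \<Longrightarrow> (1 - cmod z) * cmod (deriv f z) \<le> K"
    using one_minus_norm_deriv_bounded[OF hol fin] by blast
  show ?thesis
  \<comment> \<open>The first two terms bound |G(0)|, the third bounds the variation of
    \<open>G\<close>, and \<open>K\<close> bounds the difference between f(z) and G(|z|).\<close>
  proof (rule that[of "cmod (f 0) + cmod (deriv f 0) + 256 * N + K"])
    fix z :: complex assume z: "z \<in> unit_disc"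
    obtain \<zeta> where \<zeta>: "cmod \<zeta> = 1" "z = of_real (cmod z) * \<zeta>" by (rule unit_direction)
    define x where "x = cmod z"
    have x: "0 \<le> x" "x < 1" using z by (auto simp: x_def)
    \<comment> \<open>On the ray the factor \<zeta> - t \<zeta> equals (1 - t) \<zeta>. In the
      product rule the two terms with f' cancel, which leaves \<open>g\<close> as the derivative of
      \<open>G\<close>.\<close>
    define G where "G = (\<lambda>t::real. f (of_real t * \<zeta>) + (1 - t) *\<^sub>R (\<zeta> * deriv f (of_real t * \<zeta>)))"
    define g where "g = (\<lambda>t::real. (1 - t) *\<^sub>R (\<zeta> * (?h (of_real t * \<zeta>) * \<zeta>)))"
    have disc: "of_real t * \<zeta> \<in> unit_disc" if "0 \<le> t" "t \<le> x" for t :: real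
      using that x \<zeta> by (simp add: norm_mult)
    have der: "(G has_vector_derivative g t) (at t within {0..x})" if t: "t \<in> {0..x}" for t
    proof -
      have a: "((\<lambda>t. f (of_real t * \<zeta>)) has_vector_derivative deriv f (of_real t * \<zeta>) * \<zeta>) (at t within {0..x})"
        using hol disc t by (intro has_vector_derivative_along_ray holomorphic_derivI) auto
      have b: "((\<lambda>t. deriv f (of_real t * \<zeta>)) has_vector_derivative ?h (of_real t * \<zeta>) * \<zeta>) (at t within {0..x})"
        using hol1 disc t by (intro has_vector_derivative_along_ray holomorphic_derivI) auto
      have c: "((\<lambda>t. 1 - t) has_real_derivative -1) (at t within {0..x})"
        by (auto intro!: derivative_eq_intros)
      show ?thesis
        unfolding G_def
        by (rule has_vector_derivative_eq_rhs[OF has_vector_derivative_add[OF a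
              has_vector_derivative_scaleR[OF c has_vector_derivative_mult_right[OF b]]]])
           (simp add: g_def mult.commute)
    qed
    have "continuous_on {0..x} (\<lambda>t. ?h (of_real t * \<zeta>))"
      using disc by (intro continuous_on_compose2[OF holomorphic_on_imp_continuous_on[OF hol2]] continuous_intros) auto
    then have cont: "continuous_on {0..x} g"
      unfolding g_def by (intro continuous_intros)
    \<comment> \<open>\<open>E t w\<close> indicates that w lies in the disc about t \<zeta> of
      radius (1 - t)/2. As a function of both variables it allows integration over t first, for
      fixed w.\<close>
    define E where "E = (\<lambda>t w. if cmod (w - of_real t * \<zeta>) < (1 - t) / 2 then 1 else 0 :: ennreal)"
    have E_meas [measurable]: "(\<lambda>p. E (fst p) (snd p)) \<in> borel_measurable (lborel \<Otimes>\<^sub>M lborel)"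
      unfolding E_def by measurable
    \<comment> \<open>With R = (1 - t)/2, the modulus of \<open>g t\<close> is 2 R |f''|, and the
      mean value inequality contributes 32 / R^2. The product 64 / R is 128 / (1 - t).\<close>
    have g_le: "ennreal (cmod (g t)) \<le> ennreal (128 / (1 - t)) * (\<integral>\<^sup>+w. E t w * H w \<partial>lborel)"
      if t: "t \<in> {0..x}" for t
    proof -
      define R where "R = (1 - t) / 2"
      have R: "R > 0" using t x by (simp add: R_def)
      have sub: "ball (of_real t * \<zeta>) R \<subseteq> unit_disc"
      proof
        fix w assume "w \<in> ball (of_real t * \<zeta>) R"
        then have "cmod (w - of_real t * \<zeta>) < R" by (simp add: dist_norm norm_minus_commute)
        moreover have "cmod (of_real t * \<zeta>) = t" using t \<zeta> by (simp add: norm_mult)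
        ultimately show "w \<in> unit_disc"
          using norm_triangle_sub[of w "of_real t * \<zeta>"] R by (simp add: R_def)
      qed
      have "ennreal (cmod (?h (of_real t * \<zeta>)) * R\<^sup>2)
          \<le> 32 * (\<integral>\<^sup>+w\<in>ball (of_real t * \<zeta>) R. ennreal (cmod (?h w)) \<partial>lborel)"
        using R sub hol2 by (intro holomorphic_area_submean) (auto intro: holomorphic_on_subset)
      also have "(\<integral>\<^sup>+w\<in>ball (of_real t * \<zeta>) R. ennreal (cmod (?h w)) \<partial>lborel) = (\<integral>\<^sup>+w. E t w * H w \<partial>lborel)"
        using sub by (intro nn_integral_cong) (auto simp: E_def H_def R_def indicator_def dist_norm norm_minus_commute)
      finally have main: "ennreal (cmod (?h (of_real t * \<zeta>)) * R\<^sup>2) \<le> 32 * (\<integral>\<^sup>+w. E t w * H w \<partial>lborel)" .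
      have "cmod (g t) = (2 * R) * cmod (?h (of_real t * \<zeta>))"
        using t x \<zeta>(1) by (simp add: g_def norm_mult R_def)
      also have "\<dots> = 2 / R * (cmod (?h (of_real t * \<zeta>)) * R\<^sup>2)"
        using R by (simp add: power2_eq_square)
      finally have "cmod (g t) = 2 / R * (cmod (?h (of_real t * \<zeta>)) * R\<^sup>2)" .
      then have "ennreal (cmod (g t)) = ennreal (2 / R) * ennreal (cmod (?h (of_real t * \<zeta>)) * R\<^sup>2)"
        using R by (metis ennreal_mult divide_nonneg_pos mult_nonneg_nonneg norm_ge_zero zero_le_numeral zero_le_power2)
      also have "\<dots> \<le> ennreal (2 / R) * (32 * (\<integral>\<^sup>+w. E t w * H w \<partial>lborel))"
        by (intro mult_left_mono main) auto
      also have "\<dots> = ennreal (2 / R * 32) * (\<integral>\<^sup>+w. E t w * H w \<partial>lborel)"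
        using R by (simp add: ennreal_mult mult.assoc del: times_divide_eq_left)
      also have "2 / R * 32 = 128 / (1 - t)" by (simp add: R_def)
      finally show ?thesis .
    qed
    \<comment> \<open>If w lies in the disc at t, the triangle inequality places d = |\<zeta> - w|
      between (1 - t)/2 and 3(1 - t)/2. Hence t is confined to an interval of length 4d/3 on which
      128 / (1 - t) is at most 192 / d, and the product of these is 256 for every w.\<close>
    have shell: "(\<integral>\<^sup>+t. ennreal (128 / (1 - t)) * E t w * indicator {0..x} t \<partial>lborel) \<le> 256"
      if w: "w \<in> unit_disc" for w
    proof -
      define d where "d = cmod (\<zeta> - w)"
      have d: "d > 0" using w \<zeta> by (auto simp: d_def)
      have "(\<integral>\<^sup>+t. ennreal (128 / (1 - t)) * E t w * indicator {0..x} t \<partial>lborel)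
          \<le> (\<integral>\<^sup>+t. ennreal (192 / d) * indicator {1 - 2 * d..1 - 2 * d / 3} t \<partial>lborel)"
      proof (intro nn_integral_mono)
        fix t
        show "ennreal (128 / (1 - t)) * E t w * indicator {0..x} t
            \<le> ennreal (192 / d) * indicator {1 - 2 * d..1 - 2 * d / 3} t"
        proof (cases "t \<in> {0..x} \<and> cmod (w - of_real t * \<zeta>) < (1 - t) / 2")
          case True
          have "\<zeta> - of_real t * \<zeta> = of_real (1 - t) * \<zeta>" by (simp add: algebra_simps)
          then have "cmod (\<zeta> - of_real t * \<zeta>) = 1 - t"
            using True x \<zeta> by (simp only: norm_mult norm_of_real) auto
          then have "d \<le> 3/2 * (1 - t)" "1 - t \<le> 2 * d"
            using True norm_triangle_ineq4[of "\<zeta> - of_real t * \<zeta>" "w - of_real t * \<zeta>"]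
              norm_triangle_ineq2[of "\<zeta> - of_real t * \<zeta>" "w - of_real t * \<zeta>"]
            by (auto simp: d_def)
          moreover have "128 / (1 - t) \<le> 192 / d"
            using calculation True x d by (simp add: field_simps)
          ultimately show ?thesis
            using True by (auto simp: E_def indicator_def intro!: ennreal_leI)
        qed (auto simp: E_def indicator_def)
      qed
      also have "\<dots> = ennreal (192 / d) * ennreal (4 * d / 3)"
        using d by (subst nn_integral_cmult_indicator) (auto simp: field_simps)
      also have "\<dots> = 256" using d by (simp flip: ennreal_mult)
      finally show ?thesis .
    qed
    have "integral {0..x} g = G x - G 0"
      using fundamental_theorem_of_calculus[OF x(1) der] by (rule integral_unique)
    then have "ennreal (cmod (G x - G 0)) \<le> (\<integral>\<^sup>+t\<in>{0..x}. ennreal (cmod (g t)) \<partial>lborel)"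
      using ennreal_norm_integral_le[OF cont] by simp
    also have "\<dots> \<le> (\<integral>\<^sup>+t. (\<integral>\<^sup>+w. ennreal (128 / (1 - t)) * E t w * indicator {0..x} t * H w \<partial>lborel) \<partial>lborel)"
    proof (intro nn_integral_mono)
      fix t
      have [measurable]: "(\<lambda>w. E t w) \<in> borel_measurable borel" unfolding E_def by measurable
      have "(\<integral>\<^sup>+w. ennreal (128 / (1 - t)) * E t w * indicator {0..x} t * H w \<partial>lborel)
          = (\<integral>\<^sup>+w. ennreal (128 / (1 - t)) * indicator {0..x} t * (E t w * H w) \<partial>lborel)"
        by (intro nn_integral_cong) (simp add: ac_simps)
      also have "\<dots> = ennreal (128 / (1 - t)) * indicator {0..x} t * (\<integral>\<^sup>+w. E t w * H w \<partial>lborel)"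
        by (rule nn_integral_cmult) measurable
      finally show "ennreal (cmod (g t)) * indicator {0..x} t
          \<le> (\<integral>\<^sup>+w. ennreal (128 / (1 - t)) * E t w * indicator {0..x} t * H w \<partial>lborel)"
        using g_le[of t] by (auto simp: indicator_def)
    qed
    also have "\<dots> = (\<integral>\<^sup>+w. (\<integral>\<^sup>+t. ennreal (128 / (1 - t)) * E t w * indicator {0..x} t * H w \<partial>lborel) \<partial>lborel)"
      using E_meas by (subst lborel_pair.Fubini') (auto simp: case_prod_unfold)
    also have "\<dots> \<le> (\<integral>\<^sup>+w. 256 * H w \<partial>lborel)"
    proof (intro nn_integral_mono)
      fix w
      have [measurable]: "(\<lambda>t. E t w) \<in> borel_measurable borel" unfolding E_def by measurable
      have "(\<integral>\<^sup>+t. ennreal (128 / (1 - t)) * E t w * indicator {0..x} t * H w \<partial>lborel)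
          = (\<integral>\<^sup>+t. ennreal (128 / (1 - t)) * E t w * indicator {0..x} t \<partial>lborel) * H w"
        by (rule nn_integral_multc) measurable
      also have "\<dots> \<le> 256 * H w"
        using shell[of w] by (cases "w \<in> unit_disc") (auto simp: H_def intro!: mult_right_mono)
      finally show "(\<integral>\<^sup>+t. ennreal (128 / (1 - t)) * E t w * indicator {0..x} t * H w \<partial>lborel) \<le> 256 * H w" .
    qed
    also have "\<dots> = ennreal (256 * N)"
      using N by (simp add: nn_integral_cmult ennreal_mult)
    finally have G_le: "cmod (G x - G 0) \<le> 256 * N" using N by simp
    have "f z = (G x - G 0) + (f 0 + \<zeta> * deriv f 0) - (1 - x) *\<^sub>R (\<zeta> * deriv f z)"
      using \<zeta>(2) by (simp add: G_def x_def)
    then have "cmod (f z) \<le> cmod (G x - G 0) + (cmod (f 0) + cmod (\<zeta> * deriv f 0)) + cmod ((1 - x) *\<^sub>R (\<zeta> * deriv f z))"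
      by (smt (verit) norm_triangle_ineq norm_triangle_ineq4)
    also have "cmod ((1 - x) *\<^sub>R (\<zeta> * deriv f z)) \<le> K"
      using K[OF z] x \<zeta>(1) by (simp add: norm_mult x_def)
    finally show "cmod (f z) \<le> cmod (f 0) + cmod (deriv f 0) + 256 * N + K"
      using G_le \<zeta>(1) by (simp add: norm_mult)
  qed
qed

section \<open>Derivatives of the integral operators and membership in the Bloch space\<close>

text \<open>On the convex disc a holomorphic function has a primitive, and the integral over the
  segment from 0 is its increment. This yields the differentiation rules for \<open>I_op\<close> and
  \<open>T_op\<close>.\<close>

lemma has_field_derivative_integral_from_0:
  assumes hol: "u holomorphic_on unit_disc" and z: "z \<in> unit_disc"
  shows "((\<lambda>z. contour_integral (linepath 0 z) u) has_field_derivative u z) (at z)"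
proof -
  obtain U where U: "\<And>x. x \<in> unit_disc \<Longrightarrow> (U has_field_derivative u x) (at x within unit_disc)"
    using holomorphic_convex_primitive'[OF convex_ball open_ball hol] by blast
  have eq: "contour_integral (linepath 0 w) u = U w - U 0" if w: "w \<in> unit_disc" for w
  proof -
    have "path_image (linepath 0 w) \<subseteq> unit_disc"
      using w by (simp add: closed_segment_subset)
    then show ?thesis
      using contour_integral_primitive[OF U valid_path_linepath] by (auto intro: contour_integral_unique)
  qed
  have "((\<lambda>w. U w - U 0) has_field_derivative u z) (at z)"
    using U[OF z] z by (auto intro!: derivative_eq_intros simp: at_within_open[OF z open_ball])
  then show ?thesis
    by (rule has_field_derivative_transform_within_open[OF _ open_ball z]) (simp add: eq)
qed

lemma Bloch_iff_derivative:
  assumes "\<And>z. z \<in> unit_disc \<Longrightarrow> (F has_field_derivative u z) (at z)"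
  shows "F \<in> Bloch \<longleftrightarrow> (\<exists>K. \<forall>z\<in>unit_disc. (1 - (cmod z)\<^sup>2) * cmod (u z) \<le> K)"
proof -
  have "F holomorphic_on unit_disc"
    using assms by (metis holomorphic_on_open open_ball)
  moreover have "deriv F z = u z" if "z \<in> unit_disc" for z
    using assms[OF that] by (rule DERIV_imp_deriv)
  ultimately show ?thesis
    by (auto simp: Bloch_def bdd_above_def)
qed

lemma weight_bounds:
  fixes z :: complex
  assumes "z \<in> unit_disc"
  shows "0 < 1 - (cmod z)\<^sup>2" "1 - (cmod z)\<^sup>2 \<le> 2 * (1 - cmod z)"
proof -
  have "(1 - (cmod z)\<^sup>2) = (1 + cmod z) * (1 - cmod z)" by (simp add: power2_eq_square algebra_simps)
  moreover have "(1 + cmod z) * (1 - cmod z) \<le> 2 * (1 - cmod z)"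
    using assms by (intro mult_right_mono) auto
  ultimately show "1 - (cmod z)\<^sup>2 \<le> 2 * (1 - cmod z)" by simp
  show "0 < 1 - (cmod z)\<^sup>2"
    using assms by (simp add: power_less_one_iff)
qed

lemma weight_mult_le:
  fixes z :: complex
  assumes "z \<in> unit_disc" "0 \<le> c"
  shows "(1 - (cmod z)\<^sup>2) * c \<le> 2 * ((1 - cmod z) * c)"
  using mult_right_mono[OF weight_bounds(2)[OF assms(1)] assms(2)] by (simp only: mult.assoc)

lemma B_one_subset_Bloch: "B_one \<subseteq> Bloch"
proof
  fix f assume f: "f \<in> B_one"
  obtain K where K: "\<And>z. z \<in> unit_disc \<Longrightarrow> (1 - cmod z) * cmod (deriv f z) \<le> K"
    using one_minus_norm_deriv_bounded f unfolding B_one_iff by blast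
  have "(1 - (cmod z)\<^sup>2) * cmod (deriv f z) \<le> 2 * K" if z: "z \<in> unit_disc" for z
    using weight_mult_le[OF z norm_ge_zero, of "deriv f z"] K[OF z] by linarith
  then show "f \<in> Bloch"
    using f by (auto simp: B_one_iff Bloch_def intro!: bdd_aboveI2)
qed

lemma B_one_subset_H_infinity: "B_one \<subseteq> H_infinity"
proof
  fix f assume f: "f \<in> B_one"
  obtain K where "\<And>z. z \<in> unit_disc \<Longrightarrow> cmod (f z) \<le> K"
    using bounded_on_disc f unfolding B_one_iff by blast
  then show "f \<in> H_infinity"
    using f unfolding B_one_iff H_infinity_def bounded_iff by blast
qed

text \<open>Cauchy's inequality on the disc about z of radius (1 - |z|)/2 bounds |g'(z)| by 2 M / (1
  - |z|).\<close>

lemma H_infinity_subset_Bloch: "H_infinity \<subseteq> Bloch"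
proof
  fix g assume g: "g \<in> H_infinity"
  then obtain M where M: "\<And>z. z \<in> unit_disc \<Longrightarrow> cmod (g z) \<le> M"
    unfolding H_infinity_def bounded_iff by blast
  have hol: "g holomorphic_on unit_disc" using g by (simp add: H_infinity_def)
  have "(1 - (cmod z)\<^sup>2) * cmod (deriv g z) \<le> 4 * M" if z: "z \<in> unit_disc" for z
  proof -
    define r where "r = (1 - cmod z) / 2"
    have r: "r > 0" using z by (simp add: r_def)
    have sub: "cball z r \<subseteq> unit_disc"
    proof
      fix w assume "w \<in> cball z r"
      then have "cmod (w - z) \<le> r" by (simp add: dist_norm norm_minus_commute)
      then show "w \<in> unit_disc" using norm_triangle_sub[of w z] r by (simp add: r_def)
    qed
    have "cmod ((deriv ^^ 1) g z) \<le> fact 1 * M / r ^ 1"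
    proof (rule Cauchy_inequality)
      show "g holomorphic_on ball z r"
        using holomorphic_on_subset[OF hol order_trans[OF ball_subset_cball sub]] .
      show "continuous_on (cball z r) g"
        using holomorphic_on_imp_continuous_on[OF holomorphic_on_subset[OF hol sub]] .
      show "cmod (g x) \<le> M" if "cmod (z - x) = r" for x
        using that sub by (intro M) (auto simp: dist_norm subset_iff)
    qed (rule r)
    then have "(1 - cmod z) * cmod (deriv g z) \<le> 2 * M"
      using z by (simp add: r_def field_simps)
    then show ?thesis
      using weight_mult_le[OF z norm_ge_zero, of "deriv g z"] by linarith
  qed
  then show "g \<in> Bloch"
    using hol by (auto simp: Bloch_def intro!: bdd_aboveI2)
qed

section \<open>Test functions concentrated at a point of the disc\<close>

text \<open>The region is cut into dyadic annuli about w. On the k-th one the integrand is at most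
  \<open>b k\<close>, the area is at most that of the ball with the outer radius, and the products
  form a geometric series of ratio 1/4.\<close>

lemma nn_integral_inverse_fourth_power_le:
  fixes w :: complex
  assumes \<delta>: "\<delta> > 0"
  shows "(\<integral>\<^sup>+z. ennreal (1 / cmod (z - w) ^ 4) * indicator {z. \<delta> \<le> cmod (z - w)} z \<partial>lborel) \<le> ennreal (17 / \<delta>\<^sup>2)"
proof -
  define b where "b = (\<lambda>k::nat. 1 / (2 ^ k * \<delta>) ^ 4)"
  have "(\<integral>\<^sup>+z. ennreal (1 / cmod (z - w) ^ 4) * indicator {z. \<delta> \<le> cmod (z - w)} z \<partial>lborel)
      \<le> (\<integral>\<^sup>+z. (\<Sum>k. ennreal (b k) * indicator (ball w (2 ^ Suc k * \<delta>)) z) \<partial>lborel)"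
  proof (intro nn_integral_mono)
    fix z
    show "ennreal (1 / cmod (z - w) ^ 4) * indicator {z. \<delta> \<le> cmod (z - w)} z
        \<le> (\<Sum>k. ennreal (b k) * indicator (ball w (2 ^ Suc k * \<delta>)) z)"
    proof (cases "\<delta> \<le> cmod (z - w)")
      case True
      obtain n :: nat where "cmod (z - w) / \<delta> < 2 ^ n"
        using real_arch_pow[of 2 "cmod (z - w) / \<delta>"] by auto
      then have "cmod (z - w) < 2 ^ n * \<delta>" using \<delta> by (simp add: pos_divide_less_eq)
      also have "\<dots> \<le> 2 ^ Suc n * \<delta>" using \<delta> by simp
      finally have ex: "cmod (z - w) < 2 ^ Suc n * \<delta>" .
      \<comment> \<open>The least such index picks the annulus containing z: its minimality supplies
        the lower bound on the distance, or the hypothesis on \<delta> if the index is 0.\<close>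
      define k where "k = (LEAST k. cmod (z - w) < 2 ^ Suc k * \<delta>)"
      have up: "cmod (z - w) < 2 ^ Suc k * \<delta>"
        unfolding k_def using ex by (rule LeastI)
      have lo: "2 ^ k * \<delta> \<le> cmod (z - w)"
      proof (cases k)
        case (Suc j)
        then have "\<not> cmod (z - w) < 2 ^ Suc j * \<delta>"
          unfolding k_def by (metis lessI not_less_Least)
        then show ?thesis using Suc by simp
      qed (use True in simp)
      have "1 / cmod (z - w) ^ 4 \<le> b k"
        unfolding b_def using lo \<delta> True by (intro divide_left_mono power_mono mult_pos_pos zero_less_power) auto
      then have "ennreal (1 / cmod (z - w) ^ 4) \<le> (\<Sum>i\<in>{k}. ennreal (b i) * indicator (ball w (2 ^ Suc i * \<delta>)) z)"
        using up by (auto simp: dist_norm norm_minus_commute intro!: ennreal_leI)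
      also have "\<dots> \<le> (\<Sum>i. ennreal (b i) * indicator (ball w (2 ^ Suc i * \<delta>)) z)"
        by (rule sum_le_suminf) auto
      finally show ?thesis using True by simp
    qed simp
  qed
  also have "\<dots> = (\<Sum>k. \<integral>\<^sup>+z. ennreal (b k) * indicator (ball w (2 ^ Suc k * \<delta>)) z \<partial>lborel)"
    by (rule nn_integral_suminf) (intro borel_measurable_times_ennreal borel_measurable_indicator; simp)
  also have "\<dots> = (\<Sum>k. ennreal (4 * pi / \<delta>\<^sup>2 * (1 / 4) ^ k))"
  proof (intro suminf_cong)
    fix k
    have "(\<integral>\<^sup>+z. ennreal (b k) * indicator (ball w (2 ^ Suc k * \<delta>)) z \<partial>lborel)
        = ennreal (b k * (pi * (2 ^ Suc k * \<delta>)\<^sup>2))"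
      using \<delta> by (subst nn_integral_cmult_indicator)
        (auto simp: emeasure_lborel_ball_complex b_def simp flip: ennreal_mult)
    also have "b k * (pi * (2 ^ Suc k * \<delta>)\<^sup>2) = 4 * pi / \<delta>\<^sup>2 * (1 / 4) ^ k"
    proof -
      have four: "(4::real) ^ k = (2 ^ k)\<^sup>2"
        using power_mult[of "2::real" 2 k] power_mult[of "2::real" k 2] by (simp add: mult.commute)
      have "1 / (x * y) ^ 4 * (pi * (2 * x * y)\<^sup>2) = 4 * pi / y\<^sup>2 * (1 / x\<^sup>2)"
        if "x \<noteq> 0" "y \<noteq> 0" for x y :: real
        using that by (simp add: field_simps eval_nat_numeral)
      from this[of "2 ^ k" \<delta>] show ?thesis
        using \<delta> by (simp add: b_def power_one_over four)
    qed
    finally show "(\<integral>\<^sup>+z. ennreal (b k) * indicator (ball w (2 ^ Suc k * \<delta>)) z \<partial>lborel)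
        = ennreal (4 * pi / \<delta>\<^sup>2 * (1 / 4) ^ k)" .
  qed
  also have "\<dots> = ennreal (4 * pi / \<delta>\<^sup>2 * (4 / 3))"
  proof (rule suminf_ennreal_eq)
    show "(\<lambda>k. 4 * pi / \<delta>\<^sup>2 * (1 / 4) ^ k) sums (4 * pi / \<delta>\<^sup>2 * (4 / 3))"
      using geometric_sums[of "1/4 :: real"] by (intro sums_mult) simp
  qed simp
  \<comment> \<open>The sum is (16 pi / 3) / \<delta>^2, and 16 pi / 3 is less than 17.\<close>
  also have "\<dots> \<le> ennreal (17 / \<delta>\<^sup>2)"
    using pi_less_4 \<delta> pi_approx by (intro ennreal_leI) (simp add: field_simps)
  finally show ?thesis .
qed

text \<open>The divisor 6 makes the coefficient in \<open>test_fn''\<close> equal to 1 after two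
  differentiations. The factors \<open>cnj a\<close> are left in the numerators of the derivatives,
  so that all three formulas make sense for a = 0.\<close>

definition test_fn :: "complex \<Rightarrow> complex \<Rightarrow> complex" where
  "test_fn a z = of_real ((1 - (cmod a)\<^sup>2)\<^sup>2) / (6 * (1 - cnj a * z)\<^sup>2)"

definition test_fn' :: "complex \<Rightarrow> complex \<Rightarrow> complex" where
  "test_fn' a z = cnj a * of_real ((1 - (cmod a)\<^sup>2)\<^sup>2) / (3 * (1 - cnj a * z) ^ 3)"

definition test_fn'' :: "complex \<Rightarrow> complex \<Rightarrow> complex" where
  "test_fn'' a z = (cnj a)\<^sup>2 * of_real ((1 - (cmod a)\<^sup>2)\<^sup>2) / (1 - cnj a * z) ^ 4"

lemma norm_test_fn:
  "cmod (test_fn a z) = (1 - (cmod a)\<^sup>2)\<^sup>2 / (6 * (cmod (1 - cnj a * z))\<^sup>2)"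
  "cmod (test_fn' a z) = cmod a * (1 - (cmod a)\<^sup>2)\<^sup>2 / (3 * cmod (1 - cnj a * z) ^ 3)"
  "cmod (test_fn'' a z) = (cmod a)\<^sup>2 * (1 - (cmod a)\<^sup>2)\<^sup>2 / cmod (1 - cnj a * z) ^ 4"
  unfolding test_fn_def test_fn'_def test_fn''_def
  by (simp_all only: norm_divide norm_mult norm_power norm_of_real complex_mod_cnj norm_numeral abs_power2)

text \<open>Since |a| |z| is at most both |a| and |z|, the denominator of the test functions
  dominates, up to a factor 2, the weights at \<open>a\<close> and at \<open>z\<close>.\<close>

lemma norm_one_minus_cnj_mult_ge:
  assumes "a \<in> unit_disc" "z \<in> unit_disc"
  shows "1 - cmod a \<le> cmod (1 - cnj a * z)" "1 - cmod z \<le> cmod (1 - cnj a * z)" "1 - cnj a * z \<noteq> 0"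
proof -
  have "1 - cmod a * cmod z \<le> cmod (1 - cnj a * z)"
    using norm_triangle_ineq2[of 1 "cnj a * z"] by (simp add: norm_mult)
  moreover have "cmod a * cmod z \<le> cmod a" "cmod a * cmod z \<le> cmod z"
    using assms by (simp_all add: mult_right_le_one_le mult_left_le_one_le)
  ultimately show "1 - cmod a \<le> cmod (1 - cnj a * z)" "1 - cmod z \<le> cmod (1 - cnj a * z)"
    by linarith+
  then show "1 - cnj a * z \<noteq> 0" using assms by auto
qed

lemma test_fn_derivatives:
  assumes "a \<in> unit_disc" "z \<in> unit_disc"
  shows "(test_fn a has_field_derivative test_fn' a z) (at z)"
    and "(test_fn' a has_field_derivative test_fn'' a z) (at z)"
proof -
  have nz: "1 - cnj a * z \<noteq> 0" using norm_one_minus_cnj_mult_ge(3)[OF assms] .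
  show "(test_fn a has_field_derivative test_fn' a z) (at z)"
    unfolding test_fn_def test_fn'_def using nz
    by (auto intro!: derivative_eq_intros simp: divide_simps) (simp add: eval_nat_numeral algebra_simps)
  show "(test_fn' a has_field_derivative test_fn'' a z) (at z)"
    unfolding test_fn'_def test_fn''_def using nz
    by (auto intro!: derivative_eq_intros simp: divide_simps) (simp add: eval_nat_numeral algebra_simps)
qed

lemma norm_test_fn_le:
  assumes "a \<in> unit_disc" "z \<in> unit_disc"
  shows "cmod (test_fn a z) \<le> 1"
proof -
  have a: "0 \<le> 1 - (cmod a)\<^sup>2" "1 - (cmod a)\<^sup>2 \<le> 2 * cmod (1 - cnj a * z)"
    using weight_bounds[OF assms(1)] norm_one_minus_cnj_mult_ge(1)[OF assms] by simp_all
  have "(1 - (cmod a)\<^sup>2)\<^sup>2 \<le> (2 * cmod (1 - cnj a * z))\<^sup>2"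
    using a by (intro power_mono)
  then have "(1 - (cmod a)\<^sup>2)\<^sup>2 \<le> 6 * (cmod (1 - cnj a * z))\<^sup>2"
    by (simp add: power_mult_distrib) (smt (verit) zero_le_power2)
  then show ?thesis
    using norm_one_minus_cnj_mult_ge(3)[OF assms]
    by (simp add: norm_test_fn divide_simps)
qed

text \<open>Each of the three weight factors in the numerator is at most 2 |1 - cnj a z|. The bound
  is uniform in \<open>a\<close>, which controls the later terms of the gliding hump series.\<close>

lemma test_fn'_le:
  assumes "a \<in> unit_disc" "z \<in> unit_disc"
  shows "(1 - (cmod z)\<^sup>2) * cmod (test_fn' a z) \<le> 8/3"
proof -
  let ?d = "cmod (1 - cnj a * z)"
  have d: "?d > 0" using norm_one_minus_cnj_mult_ge(3)[OF assms] by simp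
  have a: "0 \<le> 1 - (cmod a)\<^sup>2" "1 - (cmod a)\<^sup>2 \<le> 2 * ?d"
    using weight_bounds[OF assms(1)] norm_one_minus_cnj_mult_ge(1)[OF assms] by simp_all
  have z: "0 \<le> 1 - (cmod z)\<^sup>2" "1 - (cmod z)\<^sup>2 \<le> 2 * ?d"
    using weight_bounds[OF assms(2)] norm_one_minus_cnj_mult_ge(2)[OF assms] by simp_all
  have "(1 - (cmod z)\<^sup>2) * (cmod a * (1 - (cmod a)\<^sup>2)\<^sup>2) \<le> (2 * ?d) * (1 * (2 * ?d)\<^sup>2)"
    using a z assms by (intro mult_mono power_mono) auto
  also have "\<dots> = 8 / 3 * (3 * ?d ^ 3)" by (simp add: eval_nat_numeral)
  finally show ?thesis
    using d by (simp add: norm_test_fn pos_divide_le_eq)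
qed

text \<open>At z = a the denominator is real and a power of the weight, so all weights cancel. This
  is the size of the hump.\<close>

lemma test_fn'_at_center:
  assumes "a \<in> unit_disc"
  shows "(1 - (cmod a)\<^sup>2) * cmod (test_fn' a a) = cmod a / 3"
proof -
  have "1 - cnj a * a = of_real (1 - (cmod a)\<^sup>2)"
    using complex_norm_square[of a] by (simp add: mult.commute)
  then have "cmod (1 - cnj a * a) = 1 - (cmod a)\<^sup>2"
    using weight_bounds(1)[OF assms] by (simp only: norm_of_real)
  moreover have "s * (c * s\<^sup>2 / (3 * s ^ 3)) = c / 3" if "s > 0" for s c :: real
    using that by (simp add: eval_nat_numeral)
  ultimately show ?thesis
    using weight_bounds(1)[OF assms] by (simp only: norm_test_fn)
qed

text \<open>The pole w = 1 / cnj a has distance at least \<delta> from each point of the disc, so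
  the integral of the inverse fourth power applies. The weight cancels 1 / \<delta>^2 up to (1 +
  |a|)^2, which leaves 17 * 4 = 68 for all \<open>a\<close>.\<close>

lemma nn_integral_test_fn''_le:
  assumes a: "a \<in> unit_disc" "a \<noteq> 0"
  shows "(\<integral>\<^sup>+z\<in>unit_disc. ennreal (cmod (test_fn'' a z)) \<partial>lborel) \<le> 68"
proof -
  define w where "w = 1 / cnj a"
  define \<delta> where "\<delta> = (1 - cmod a) / cmod a"
  define C where "C = (1 - (cmod a)\<^sup>2)\<^sup>2 / (cmod a)\<^sup>2"
  have \<delta>: "\<delta> > 0" using a by (simp add: \<delta>_def)
  have C: "C \<ge> 0" by (simp add: C_def)
  have fac: "1 - cnj a * z = cnj a * (w - z)" for z
    using a by (simp add: w_def field_simps)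
  have "(\<integral>\<^sup>+z\<in>unit_disc. ennreal (cmod (test_fn'' a z)) \<partial>lborel)
      \<le> (\<integral>\<^sup>+z. ennreal C * (ennreal (1 / cmod (z - w) ^ 4) * indicator {z. \<delta> \<le> cmod (z - w)} z) \<partial>lborel)"
  proof (intro nn_integral_mono)
    fix z
    show "ennreal (cmod (test_fn'' a z)) * indicator unit_disc z
        \<le> ennreal C * (ennreal (1 / cmod (z - w) ^ 4) * indicator {z. \<delta> \<le> cmod (z - w)} z)"
    proof (cases "z \<in> unit_disc")
      case True
      have "1 - cmod a \<le> cmod a * cmod (z - w)"
        using norm_one_minus_cnj_mult_ge(1)[OF a(1) True] unfolding fac
        by (simp add: norm_mult norm_minus_commute)
      then have "\<delta> \<le> cmod (z - w)" using a by (simp add: \<delta>_def field_simps)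
      moreover have "cmod (test_fn'' a z) = C * (1 / cmod (z - w) ^ 4)"
      proof -
        have "x\<^sup>2 * y / (x * v) ^ 4 = y / x\<^sup>2 * (1 / v ^ 4)" if "x \<noteq> 0" for x y v :: real
          using that by (simp add: field_simps eval_nat_numeral)
        then show ?thesis
          using a by (simp add: norm_test_fn fac C_def norm_mult norm_minus_commute[of w z])
      qed
      ultimately show ?thesis using True C by (simp add: ennreal_mult' flip: ennreal_mult)
    qed simp
  qed
  also have "\<dots> = ennreal C * (\<integral>\<^sup>+z. ennreal (1 / cmod (z - w) ^ 4) * indicator {z. \<delta> \<le> cmod (z - w)} z \<partial>lborel)"
    by (rule nn_integral_cmult) measurable
  also have "\<dots> \<le> ennreal C * ennreal (17 / \<delta>\<^sup>2)"
    by (intro mult_left_mono nn_integral_inverse_fourth_power_le \<delta>) auto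
  also have "\<dots> = ennreal (C * (17 / \<delta>\<^sup>2))" using C \<delta> by (intro ennreal_mult[symmetric]) auto
  also have "C * (17 / \<delta>\<^sup>2) = 17 * (1 + cmod a)\<^sup>2"
  proof -
    have "1 - (cmod a)\<^sup>2 = (1 + cmod a) * (1 - cmod a)" by (simp add: power2_eq_square algebra_simps)
    then show ?thesis using a by (simp add: C_def \<delta>_def power_divide power_mult_distrib)
  qed
  also have "ennreal (17 * (1 + cmod a)\<^sup>2) \<le> ennreal (17 * 2\<^sup>2)"
    using a by (intro ennreal_leI mult_left_mono power_mono) auto
  finally show ?thesis by simp
qed

lemma B_oneI:
  assumes F: "\<And>z. z \<in> unit_disc \<Longrightarrow> (F has_field_derivative F' z) (at z)"
    and F': "\<And>z. z \<in> unit_disc \<Longrightarrow> (F' has_field_derivative F'' z) (at z)"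
    and fin: "(\<integral>\<^sup>+z\<in>unit_disc. ennreal (cmod (F'' z)) \<partial>lborel) < \<infinity>"
  shows "F \<in> B_one"
proof -
  have "deriv (deriv F) z = F'' z" if z: "z \<in> unit_disc" for z
  proof (rule DERIV_imp_deriv)
    show "(deriv F has_field_derivative F'' z) (at z)"
      by (rule has_field_derivative_transform_within_open[OF F'[OF z] open_ball z])
         (metis F DERIV_imp_deriv)
  qed
  then have "(\<integral>\<^sup>+z\<in>unit_disc. ennreal (cmod (deriv (deriv F) z)) \<partial>lborel)
      = (\<integral>\<^sup>+z\<in>unit_disc. ennreal (cmod (F'' z)) \<partial>lborel)"
    by (intro nn_integral_cong) (auto simp: indicator_def)
  moreover have "F holomorphic_on unit_disc"
    using F by (metis holomorphic_on_open open_ball)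
  ultimately show ?thesis using fin by (simp add: B_one_iff)
qed

section \<open>Geometrically weighted series of test functions\<close>

text \<open>The triangle inequality for partial sums passes to the limit; the right-hand side may be
  infinite.\<close>

lemma ennreal_norm_sums_le:
  fixes f :: "nat \<Rightarrow> 'a::real_normed_vector"
  assumes "f sums s"
  shows "ennreal (norm s) \<le> (\<Sum>n. ennreal (norm (f n)))"
proof (rule LIMSEQ_le_const2)
  show "(\<lambda>n. ennreal (norm (\<Sum>k<n. f k))) \<longlonglongrightarrow> ennreal (norm s)"
    using assms unfolding sums_def by (intro tendsto_ennrealI tendsto_norm)
  have "ennreal (norm (\<Sum>k<n. f k)) \<le> (\<Sum>n. ennreal (norm (f n)))" for n
  proof -
    have "ennreal (norm (\<Sum>k<n. f k)) \<le> (\<Sum>k<n. ennreal (norm (f k)))"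
      by (simp add: sum_ennreal norm_sum ennreal_leI)
    also have "\<dots> \<le> (\<Sum>n. ennreal (norm (f n)))"
      by (rule sum_le_suminf) auto
    finally show ?thesis .
  qed
  then show "\<exists>N. \<forall>n\<ge>N. ennreal (norm (\<Sum>k<n. f k)) \<le> (\<Sum>n. ennreal (norm (f n)))"
    by blast
qed

lemma test_fn_in_B_one:
  assumes "a \<in> unit_disc" "a \<noteq> 0"
  shows "test_fn a \<in> B_one"
  using test_fn_derivatives[OF assms(1)] nn_integral_test_fn''_le[OF assms]
  by (intro B_oneI[where F' = "test_fn' a" and F'' = "test_fn'' a"]) (auto intro: le_less_trans)

text \<open>The comparison theorem for differentiated series is applied twice, to the
  \<open>test_fn\<close> series and to the \<open>test_fn'\<close> series. The uniform bound 68 and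
  summation under the integral then give the finite integral of the second derivative.\<close>

lemma test_fn_series_in_B_one:
  assumes a: "\<And>n. a n \<in> unit_disc" "\<And>n. a n \<noteq> 0" and q: "0 < q" "q < (1::real)"
  obtains F where "F \<in> B_one"
    "\<And>z. z \<in> unit_disc \<Longrightarrow> (\<lambda>n. of_real (q ^ n) * test_fn' (a n) z) sums deriv F z"
proof -
  have summable: "summable (\<lambda>n. complex_of_real (q ^ n * c))" for c
    using q by (intro summable_of_real summable_mult2 summable_geometric) auto
  have "\<exists>F F1. \<forall>z\<in>unit_disc. (\<lambda>n. of_real (q ^ n) * test_fn (a n) z) sums F z \<and>
      (\<lambda>n. of_real (q ^ n) * test_fn' (a n) z) sums F1 z \<and> (F has_field_derivative F1 z) (at z)"
  proof (rule series_and_derivative_comparison_complex[OF open_ball])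
    show "((\<lambda>z. of_real (q ^ n) * test_fn (a n) z) has_field_derivative of_real (q ^ n) * test_fn' (a n) z) (at z)"
      if "z \<in> unit_disc" for n z
      using a that by (intro DERIV_cmult test_fn_derivatives)
    show "\<exists>d h. 0 < d \<and> summable h \<and> range h \<subseteq> \<real>\<^sub>\<ge>\<^sub>0 \<and> (\<forall>\<^sub>F n in sequentially.
        \<forall>y\<in>ball z d \<inter> unit_disc. cmod (of_real (q ^ n) * test_fn (a n) y) \<le> cmod (h n))"
      if "z \<in> unit_disc" for z
      using summable[of 1] q norm_test_fn_le[OF a(1)]
      by (intro exI[of _ 1] exI[of _ "\<lambda>n. of_real (q ^ n * 1)"])
         (auto simp: norm_mult norm_power intro!: mult_left_le always_eventually)
  qed
  then obtain F F1 where F: "\<And>z. z \<in> unit_disc \<Longrightarrow> (\<lambda>n. of_real (q ^ n) * test_fn' (a n) z) sums F1 z"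
      "\<And>z. z \<in> unit_disc \<Longrightarrow> (F has_field_derivative F1 z) (at z)"
    by blast
  have "\<exists>F1 F2. \<forall>z\<in>unit_disc. (\<lambda>n. of_real (q ^ n) * test_fn' (a n) z) sums F1 z \<and>
      (\<lambda>n. of_real (q ^ n) * test_fn'' (a n) z) sums F2 z \<and> (F1 has_field_derivative F2 z) (at z)"
  proof (rule series_and_derivative_comparison_complex[OF open_ball])
    show "((\<lambda>z. of_real (q ^ n) * test_fn' (a n) z) has_field_derivative of_real (q ^ n) * test_fn'' (a n) z) (at z)"
      if "z \<in> unit_disc" for n z
      using a that by (intro DERIV_cmult test_fn_derivatives)
    fix z :: complex assume z: "z \<in> unit_disc"
    \<comment> \<open>The functions \<open>test_fn' (a n)\<close> have a common bound only away from
      the boundary. On the ball of radius \<open>d\<close> the distance to the unit circle is still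
      at least \<open>d\<close>, so 8/3 / d serves for all n.\<close>
    define d where "d = (1 - cmod z) / 2"
    have d: "d > 0" using z by (simp add: d_def)
    have bound: "cmod (test_fn' (a n) y) \<le> 8 / 3 / d" if y: "y \<in> ball z d \<inter> unit_disc" for n y
    proof -
      have "cmod y < cmod z + d"
        using y norm_triangle_sub[of y z] by (simp add: dist_norm norm_minus_commute)
      then have "d \<le> 1 - cmod y"
        unfolding d_def by (simp add: field_simps)
      also have "\<dots> \<le> 1 - (cmod y)\<^sup>2"
        using y by (simp add: power2_eq_square mult_left_le)
      finally have "d \<le> 1 - (cmod y)\<^sup>2" .
      then have "d * cmod (test_fn' (a n) y) \<le> (1 - (cmod y)\<^sup>2) * cmod (test_fn' (a n) y)"
        by (intro mult_right_mono) auto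
      also have "\<dots> \<le> 8 / 3" using test_fn'_le[OF a(1)] y by blast
      finally show ?thesis using d by (simp add: field_simps)
    qed
    show "\<exists>d h. 0 < d \<and> summable h \<and> range h \<subseteq> \<real>\<^sub>\<ge>\<^sub>0 \<and> (\<forall>\<^sub>F n in sequentially.
        \<forall>y\<in>ball z d \<inter> unit_disc. cmod (of_real (q ^ n) * test_fn' (a n) y) \<le> cmod (h n))"
    proof (intro exI conjI)
      show "summable (\<lambda>n. complex_of_real (q ^ n * (8 / 3 / d)))" by (rule summable)
      show "range (\<lambda>n. complex_of_real (q ^ n * (8 / 3 / d))) \<subseteq> \<real>\<^sub>\<ge>\<^sub>0"
        using q d by (auto simp del: of_real_mult of_real_power)
      have "cmod (of_real (q ^ n) * test_fn' (a n) y) \<le> cmod (complex_of_real (q ^ n * (8 / 3 / d)))"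
        if "y \<in> ball z d \<inter> unit_disc" for n y
        unfolding norm_mult norm_of_real abs_mult
        using bound[OF that] d by (intro mult_left_mono) auto
      then show "\<forall>\<^sub>F n in sequentially. \<forall>y\<in>ball z d \<inter> unit_disc.
          cmod (of_real (q ^ n) * test_fn' (a n) y) \<le> cmod (complex_of_real (q ^ n * (8 / 3 / d)))"
        by (intro always_eventually) blast
    qed (rule d)
  qed
  then obtain F1' F2 where F1': "\<And>z. z \<in> unit_disc \<Longrightarrow> (\<lambda>n. of_real (q ^ n) * test_fn' (a n) z) sums F1' z"
      "\<And>z. z \<in> unit_disc \<Longrightarrow> (F1' has_field_derivative F2 z) (at z)"
    and F2: "\<And>z. z \<in> unit_disc \<Longrightarrow> (\<lambda>n. of_real (q ^ n) * test_fn'' (a n) z) sums F2 z"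
    by blast
  \<comment> \<open>The two applications name the sum of the first derivatives separately;
    uniqueness of sums identifies the names.\<close>
  have F_der: "(F has_field_derivative F1' z) (at z)" if "z \<in> unit_disc" for z
    using F(2)[OF that] sums_unique2[OF F(1)[OF that] F1'(1)[OF that]] by simp
  have meas: "(\<lambda>z. ennreal (cmod (test_fn'' (a n) z)) * indicator unit_disc z) \<in> borel_measurable borel" for n
    unfolding test_fn''_def using norm_one_minus_cnj_mult_ge(3)[OF a(1)]
    by (intro borel_measurable_norm_indicator continuous_intros) auto
  have "(\<integral>\<^sup>+z\<in>unit_disc. ennreal (cmod (F2 z)) \<partial>lborel)
      \<le> (\<integral>\<^sup>+z. (\<Sum>n. ennreal (q ^ n) * (ennreal (cmod (test_fn'' (a n) z)) * indicator unit_disc z)) \<partial>lborel)"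
  proof (intro nn_integral_mono)
    fix z
    show "ennreal (cmod (F2 z)) * indicator unit_disc z
        \<le> (\<Sum>n. ennreal (q ^ n) * (ennreal (cmod (test_fn'' (a n) z)) * indicator unit_disc z))"
      using ennreal_norm_sums_le[OF F2[of z]] q
      by (cases "z \<in> unit_disc") (auto simp: norm_mult norm_power ennreal_mult)
  qed
  also have "\<dots> = (\<Sum>n. ennreal (q ^ n) * (\<integral>\<^sup>+z\<in>unit_disc. ennreal (cmod (test_fn'' (a n) z)) \<partial>lborel))"
    using meas by (subst nn_integral_suminf) (auto simp: nn_integral_cmult)
  also have "\<dots> \<le> (\<Sum>n. ennreal (q ^ n * 68))"
    using nn_integral_test_fn''_le[OF a] q
    by (intro suminf_le) (auto simp: ennreal_mult intro!: mult_left_mono)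
  also have "\<dots> = ennreal (1 / (1 - q) * 68)"
    using q geometric_sums[of q] by (intro suminf_ennreal_eq sums_mult2) auto
  finally have "(\<integral>\<^sup>+z\<in>unit_disc. ennreal (cmod (F2 z)) \<partial>lborel) < \<infinity>"
    by (rule le_less_trans) simp
  then have "F \<in> B_one"
    using F_der F1'(2) by (intro B_oneI)
  moreover have "deriv F z = F1' z" if "z \<in> unit_disc" for z
    using F_der[OF that] by (rule DERIV_imp_deriv)
  ultimately show ?thesis using that F1'(1) by metis
qed

section \<open>The gliding hump argument\<close>

text \<open>The points are chosen one after another. Terms before the n-th are controlled by
  applying the hypothesis to each test function singly, which bounds them by constants
  \<open>B (a k)\<close> known before \<open>a n\<close> is chosen; terms after it are controlled by
  the uniform bound 8/3.\<close>

lemma H_infinity_if_multiplies_derivatives: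
  assumes hol: "g holomorphic_on unit_disc"
    and mult: "\<And>f. f \<in> B_one \<Longrightarrow> \<exists>K. \<forall>z\<in>unit_disc. (1 - (cmod z)\<^sup>2) * cmod (g z * deriv f z) \<le> K"
  shows "g \<in> H_infinity"
proof (rule ccontr)
  assume not: "g \<notin> H_infinity"
  \<comment> \<open>With ratio 1/33 the terms after the n-th contribute at most half of the lower bound
    \<open>q ^ n / 6\<close> for the n-th term.\<close>
  define q where "q = (1 / 33 :: real)"
  \<comment> \<open>On the compact disc of radius 1/2 the function g is bounded, so large values
    occur with |a| at least 1/2. There the hump |a|/3 is at least 1/6.\<close>
  have large: "\<exists>a\<in>unit_disc. 1/2 \<le> cmod a \<and> M \<le> cmod (g a)" for M
  proof (rule ccontr)
    assume "\<not> ?thesis"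
    then have outer: "cmod (g z) \<le> M" if "z \<in> unit_disc" "1/2 \<le> cmod z" for z
      using that by force
    have "continuous_on (cball 0 (1/2)) g"
      using hol by (intro holomorphic_on_imp_continuous_on) (auto intro: holomorphic_on_subset)
    then have "bounded (g ` cball 0 (1/2))"
      by (intro compact_imp_bounded compact_continuous_image) auto
    then obtain M' where "\<And>z. cmod z \<le> 1/2 \<Longrightarrow> cmod (g z) \<le> M'"
      unfolding bounded_iff by (metis imageI mem_cball_0)
    then have "cmod (g z) \<le> max M M'" if "z \<in> unit_disc" for z
      using outer[OF that] by (cases "cmod z \<le> 1/2") (auto simp: le_max_iff_disj)
    then have "bounded (g ` unit_disc)" unfolding bounded_iff by blast
    then show False using hol not by (simp add: H_infinity_def)
  qed
  have "\<exists>K. \<forall>z\<in>unit_disc. (1 - (cmod z)\<^sup>2) * cmod (g z * test_fn' a z) \<le> K"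
    if a: "a \<in> unit_disc" "a \<noteq> 0" for a
  proof -
    have "deriv (test_fn a) z = test_fn' a z" if "z \<in> unit_disc" for z
      using test_fn_derivatives(1)[OF a(1) that] by (rule DERIV_imp_deriv)
    then show ?thesis using mult[OF test_fn_in_B_one[OF a]] by simp
  qed
  then obtain B where B: "\<And>a z. a \<in> unit_disc \<Longrightarrow> a \<noteq> 0 \<Longrightarrow> z \<in> unit_disc \<Longrightarrow>
      (1 - (cmod z)\<^sup>2) * cmod (g z * test_fn' a z) \<le> B a"
    by metis
  \<comment> \<open>Besides the current point, the state carries in \<open>S\<close> the accumulated
    bound for the earlier terms, so the next choice depends only on the present state. The factor 12
    * 33^n is the reciprocal of q^n / 12.\<close>
  define P where "P = (\<lambda>n::nat. \<lambda>(a::complex, S::real). a \<in> unit_disc \<and> 1/2 \<le> cmod a \<and>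
      12 * 33 ^ n * (real n + S) \<le> cmod (g a) \<and> (n = 0 \<longrightarrow> S = 0))"
  define Q where "Q = (\<lambda>n::nat. \<lambda>(a::complex, S::real) (a'::complex, S'::real). S' = S + q ^ n * B a)"
  have "\<exists>x. \<forall>n. P n (x n) \<and> Q n (x n) (x (Suc n))"
  proof (rule dependent_nat_choice)
    show "\<exists>x. P 0 x"
      using large[of 0] by (auto simp: P_def)
    show "\<exists>y. P (Suc n) y \<and> Q n x y" if "P n x" for x n
      using large[of "12 * 33 ^ Suc n * (real (Suc n) + (snd x + q ^ n * B (fst x)))"]
      by (auto simp: P_def Q_def case_prod_unfold)
  qed
  then obtain x where x: "\<And>n. P n (x n)" "\<And>n. Q n (x n) (x (Suc n))" by blast
  define a where "a = (\<lambda>n. fst (x n))"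
  have S: "snd (x n) = (\<Sum>k<n. q ^ k * B (a k))" for n
  proof (induction n)
    case 0 then show ?case using x(1)[of 0] by (simp add: P_def case_prod_unfold)
  next
    case (Suc n) then show ?case using x(2)[of n] by (simp add: Q_def case_prod_unfold a_def)
  qed
  have a: "a n \<in> unit_disc" "1/2 \<le> cmod (a n)"
      and g_large: "12 * 33 ^ n * (real n + (\<Sum>k<n. q ^ k * B (a k))) \<le> cmod (g (a n))" for n
    using x(1)[of n] by (simp_all add: P_def case_prod_unfold a_def flip: S[unfolded a_def])
  have a_nz: "a n \<noteq> 0" for n using a(2)[of n] by auto
  obtain F where F: "F \<in> B_one"
      "\<And>z. z \<in> unit_disc \<Longrightarrow> (\<lambda>n. of_real (q ^ n) * test_fn' (a n) z) sums deriv F z"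
    using test_fn_series_in_B_one[of a q] a a_nz by (auto simp: q_def)
  obtain K where K: "\<And>z. z \<in> unit_disc \<Longrightarrow> (1 - (cmod z)\<^sup>2) * cmod (g z * deriv F z) \<le> K"
    using mult[OF F(1)] by blast
  have "real n \<le> K" for n
  proof -
    define z where "z = a n"
    define W where "W = 1 - (cmod z)\<^sup>2"
    define t where "t = (\<lambda>k. of_real (q ^ k) * test_fn' (a k) z)"
    have z: "z \<in> unit_disc" using a by (simp add: z_def)
    have W: "W > 0" using weight_bounds(1)[OF z] by (simp add: W_def)
    have norm_t: "W * cmod (t k) = q ^ k * (W * cmod (test_fn' (a k) z))" for k
      by (simp add: t_def norm_mult norm_power q_def)
    have tail_sums: "(\<lambda>k. t (k + Suc n)) sums (deriv F z - (\<Sum>k<Suc n. t k))"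
      using F(2)[OF z] unfolding t_def by (rule sums_split_initial_segment)
    define tail where "tail = deriv F z - (\<Sum>k<Suc n. t k)"
    \<comment> \<open>The geometric tail is bounded with 8/3 * (1/33) * (33/32) = 1/12.\<close>
    have tail: "W * cmod tail \<le> q ^ n / 12"
    proof -
      have "(\<lambda>k. 8/3 * q ^ Suc n * q ^ k) sums (8/3 * q ^ Suc n * (33/32))"
        using geometric_sums[of q] by (intro sums_mult) (simp add: q_def)
      moreover have "cmod (of_real W * t (k + Suc n)) \<le> 8/3 * q ^ Suc n * q ^ k" for k
      proof -
        have "cmod (of_real W * t (k + Suc n)) = q ^ (k + Suc n) * (W * cmod (test_fn' (a (k + Suc n)) z))"
          unfolding norm_t[symmetric] using W by (simp add: norm_mult)
        also have "\<dots> \<le> q ^ (k + Suc n) * (8/3)"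
          using test_fn'_le[OF a(1) z] by (intro mult_left_mono) (auto simp: W_def q_def)
        finally show ?thesis by (simp add: power_add mult_ac)
      qed
      moreover have "(\<lambda>k. of_real W * t (k + Suc n)) sums (of_real W * tail)"
        unfolding tail_def by (intro sums_mult tail_sums)
      ultimately have "cmod (of_real W * tail) \<le> 8/3 * q ^ Suc n * (33/32)"
        using norm_suminf_le[of "\<lambda>k. of_real W * t (k + Suc n)" "\<lambda>k. 8/3 * q ^ Suc n * q ^ k"]
        by (simp add: sums_iff)
      then show ?thesis using W by (simp add: norm_mult q_def)
    qed
    have main: "q ^ n / 6 \<le> W * cmod (t n)"
    proof -
      have "W * cmod (test_fn' (a n) z) = cmod z / 3"
        using test_fn'_at_center[OF z] by (simp add: W_def z_def)
      then show ?thesis using a(2)[of n] unfolding norm_t by (simp add: z_def q_def)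
    qed
    \<comment> \<open>Here the factor g(z) stays inside: \<open>B (a k)\<close> bounds the product
      of g with the k-th test derivative at every point of the disc.\<close>
    have head: "cmod (g z) * (W * cmod (\<Sum>k<n. t k)) \<le> (\<Sum>k<n. q ^ k * B (a k))"
    proof -
      have "cmod (g z) * (W * cmod (\<Sum>k<n. t k)) \<le> cmod (g z) * (W * (\<Sum>k<n. cmod (t k)))"
        using W by (intro mult_left_mono norm_sum) auto
      also have "\<dots> = (\<Sum>k<n. q ^ k * (W * cmod (g z * test_fn' (a k) z)))"
        by (simp add: sum_distrib_left norm_t norm_mult mult_ac)
      also have "\<dots> \<le> (\<Sum>k<n. q ^ k * B (a k))"
        using B[OF a(1) a_nz z] by (intro sum_mono mult_left_mono) (auto simp: W_def q_def)
      finally show ?thesis .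
    qed
    have t_eq: "t n = deriv F z - (\<Sum>k<n. t k) - tail"
      by (simp add: tail_def)
    have "cmod (t n) \<le> cmod (deriv F z) + cmod (\<Sum>k<n. t k) + cmod tail"
      unfolding t_eq
      using norm_triangle_ineq4[of "deriv F z - (\<Sum>k<n. t k)" tail]
        norm_triangle_ineq4[of "deriv F z" "\<Sum>k<n. t k"] by linarith
    then have "W * cmod (t n) \<le> W * (cmod (deriv F z) + cmod (\<Sum>k<n. t k) + cmod tail)"
      using W by (intro mult_left_mono) auto
    then have "q ^ n / 12 \<le> W * cmod (deriv F z) + W * cmod (\<Sum>k<n. t k)"
      using main tail by (simp add: algebra_simps)
    then have "cmod (g z) * (q ^ n / 12) \<le> cmod (g z) * (W * cmod (deriv F z) + W * cmod (\<Sum>k<n. t k))"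
      by (intro mult_left_mono) auto
    also have "\<dots> = W * cmod (g z * deriv F z) + cmod (g z) * (W * cmod (\<Sum>k<n. t k))"
      by (simp add: norm_mult algebra_simps)
    also have "\<dots> \<le> K + (\<Sum>k<n. q ^ k * B (a k))"
      using K[OF z] head by (simp add: W_def)
    finally have upper: "cmod (g z) * (q ^ n / 12) \<le> K + (\<Sum>k<n. q ^ k * B (a k))" .
    \<comment> \<open>The growth of |g(a n)| exceeds the head by exactly n. The head cancels against
      the same sum in \<open>upper\<close>, leaving n at most K for every n.\<close>
    have "12 * 33 ^ n * (real n + (\<Sum>k<n. q ^ k * B (a k))) * (q ^ n / 12) \<le> cmod (g z) * (q ^ n / 12)"
      using g_large[of n] by (intro mult_right_mono) (auto simp: z_def q_def)
    also have "12 * 33 ^ n * (real n + (\<Sum>k<n. q ^ k * B (a k))) * (q ^ n / 12)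
        = real n + (\<Sum>k<n. q ^ k * B (a k))"
    proof -
      have "33 ^ n * q ^ n = 1" by (simp add: q_def flip: power_mult_distrib)
      then have "12 * 33 ^ n * c * (q ^ n / 12) = c" for c by (simp add: mult_ac)
      then show ?thesis .
    qed
    finally show "real n \<le> K" using upper by simp
  qed
  then show False using reals_Archimedean2[of K] by (meson not_le)
qed

section \<open>Sufficiency and the three equivalences\<close>

lemma H_infinity_multiplies_derivatives:
  assumes "g \<in> H_infinity" "f \<in> Bloch"
  shows "\<exists>K. \<forall>z\<in>unit_disc. (1 - (cmod z)\<^sup>2) * cmod (g z * deriv f z) \<le> K"
proof -
  obtain M where M: "\<And>z. z \<in> unit_disc \<Longrightarrow> cmod (g z) \<le> M"
    using assms(1) unfolding H_infinity_def bounded_iff by blast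
  obtain L where L: "\<And>z. z \<in> unit_disc \<Longrightarrow> (1 - (cmod z)\<^sup>2) * cmod (deriv f z) \<le> L"
    using assms(2) unfolding Bloch_def bdd_above_def by blast
  have "(1 - (cmod z)\<^sup>2) * cmod (g z * deriv f z) \<le> M * L" if z: "z \<in> unit_disc" for z
  proof -
    have "cmod (g z) * ((1 - (cmod z)\<^sup>2) * cmod (deriv f z)) \<le> M * L"
      using M[OF z] L[OF z] weight_bounds(1)[OF z] order_trans[OF norm_ge_zero M[OF z]]
      by (intro mult_mono) auto
    then show ?thesis by (simp add: norm_mult mult_ac)
  qed
  then show ?thesis by blast
qed

lemma one_in_B_one: "(\<lambda>_. 1) \<in> B_one"
  by (rule B_oneI[where F' = "\<lambda>_. 0" and F'' = "\<lambda>_. 0"]) auto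

theorem theorem2p1:
  fixes g :: "complex \<Rightarrow> complex"
  assumes "g holomorphic_on unit_disc"
  shows "(maps_into (I_op g) B_one Bloch \<longleftrightarrow> g \<in> H_infinity) \<and>
         (maps_into (M_op g) B_one Bloch \<longleftrightarrow> g \<in> H_infinity) \<and>
         (maps_into (T_op g) B_one Bloch \<longleftrightarrow> g \<in> Bloch)"
proof -
  let ?bdd = "\<lambda>u. \<exists>K. \<forall>z\<in>unit_disc. (1 - (cmod z)\<^sup>2) * cmod (u z) \<le> K"
  note hol_g = assms
  have hol_g': "deriv g holomorphic_on unit_disc"
    using hol_g by (intro holomorphic_deriv) auto
  have hol_f: "f holomorphic_on unit_disc" if "f \<in> B_one" for f
    using that by (simp add: B_one_def)
  have mult_iff: "(\<forall>f\<in>B_one. ?bdd (\<lambda>z. g z * deriv f z)) \<longleftrightarrow> g \<in> H_infinity"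
    using H_infinity_if_multiplies_derivatives[OF hol_g] H_infinity_multiplies_derivatives B_one_subset_Bloch
    by (metis (no_types, lifting) subsetD)
  have I_iff: "I_op g f \<in> Bloch \<longleftrightarrow> ?bdd (\<lambda>z. g z * deriv f z)" if f: "f \<in> B_one" for f
    unfolding I_op_def using hol_g hol_f[OF f]
    by (intro Bloch_iff_derivative has_field_derivative_integral_from_0 holomorphic_intros) auto
  have T_iff: "T_op g f \<in> Bloch \<longleftrightarrow> ?bdd (\<lambda>z. deriv g z * f z)" if f: "f \<in> B_one" for f
    unfolding T_op_def using hol_g' hol_f[OF f]
    by (intro Bloch_iff_derivative has_field_derivative_integral_from_0 holomorphic_on_mult)
  have M_iff: "M_op g f \<in> Bloch \<longleftrightarrow> ?bdd (\<lambda>z. g z * deriv f z + deriv g z * f z)" if f: "f \<in> B_one" for f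
    unfolding M_op_def
    by (intro Bloch_iff_derivative)
       (auto intro!: derivative_eq_intros holomorphic_derivI[OF hol_g] holomorphic_derivI[OF hol_f[OF f]])
  have g_Bloch_iff: "g \<in> Bloch \<longleftrightarrow> ?bdd (deriv g)"
    using hol_g by (intro Bloch_iff_derivative holomorphic_derivI) auto
  \<comment> \<open>The multiplier lemma is used with the roles exchanged: f is the bounded factor
    and g the Bloch function.\<close>
  have T_bdd: "?bdd (\<lambda>z. deriv g z * f z)" if "g \<in> Bloch" "f \<in> B_one" for f
    using H_infinity_multiplies_derivatives[OF _ that(1), of f] that(2) B_one_subset_H_infinity
    by (auto simp: mult.commute)
  have bdd_add: "?bdd (\<lambda>z. u z + v z)" if uv: "?bdd u" "?bdd v" for u v :: "complex \<Rightarrow> complex"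
  proof -
    from uv obtain K L where "\<forall>z\<in>unit_disc. (1 - (cmod z)\<^sup>2) * cmod (u z) \<le> K"
      "\<forall>z\<in>unit_disc. (1 - (cmod z)\<^sup>2) * cmod (v z) \<le> L" by blast
    moreover have "(1 - (cmod z)\<^sup>2) * cmod (u z + v z)
        \<le> (1 - (cmod z)\<^sup>2) * cmod (u z) + (1 - (cmod z)\<^sup>2) * cmod (v z)" if "z \<in> unit_disc" for z
      using mult_left_mono[OF norm_triangle_ineq, of "1 - (cmod z)\<^sup>2" "u z" "v z"] weight_bounds(1)[OF that]
      by (simp add: distrib_left)
    ultimately show ?thesis by (intro exI[of _ "K + L"]) fastforce
  qed
  have T: "maps_into (T_op g) B_one Bloch \<longleftrightarrow> g \<in> Bloch"
  proof
    assume "maps_into (T_op g) B_one Bloch"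
    then show "g \<in> Bloch"
      using T_iff[OF one_in_B_one] one_in_B_one by (auto simp: maps_into_def g_Bloch_iff)
  next
    assume "g \<in> Bloch"
    then show "maps_into (T_op g) B_one Bloch"
      using T_iff T_bdd by (auto simp: maps_into_def)
  qed
  have M: "maps_into (M_op g) B_one Bloch \<longleftrightarrow> g \<in> H_infinity"
  proof
    assume M: "maps_into (M_op g) B_one Bloch"
    have "M_op g (\<lambda>_. 1) = g" by (simp add: M_op_def)
    then have g: "g \<in> Bloch"
      using M one_in_B_one unfolding maps_into_def by (metis image_subset_iff)
    have "?bdd (\<lambda>z. g z * deriv f z)" if f: "f \<in> B_one" for f
    proof -
      have "?bdd (\<lambda>z. g z * deriv f z + deriv g z * f z)"
        using M f M_iff[OF f] by (auto simp: maps_into_def)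
      moreover have "?bdd (\<lambda>z. - (deriv g z * f z))"
        using T_bdd[OF g f] by simp
      ultimately show ?thesis
        using bdd_add[of "\<lambda>z. g z * deriv f z + deriv g z * f z" "\<lambda>z. - (deriv g z * f z)"] by simp
    qed
    then show "g \<in> H_infinity" using mult_iff by blast
  next
    assume g: "g \<in> H_infinity"
    have "M_op g f \<in> Bloch" if f: "f \<in> B_one" for f
      unfolding M_iff[OF f] using g H_infinity_subset_Bloch mult_iff f
      by (intro bdd_add T_bdd) auto
    then show "maps_into (M_op g) B_one Bloch" by (auto simp: maps_into_def)
  qed
  have "maps_into (I_op g) B_one Bloch \<longleftrightarrow> g \<in> H_infinity"
    unfolding maps_into_def image_subset_iff mult_iff[symmetric] using I_iff by blast
  with M T show ?thesis by blast
qed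

end
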